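(* For an integer $n\geq 0$, the Lucas-Leonardo quaternion $\mathbb{Q}\mathcal{R}_{n}$ is a zero divisor in the quaternion algebra $\mathbb{Q}_{\mathbb{Z}_{7}}$ if and only if $n\equiv 0,6,7,9 \pmod{16}$.
   Context: The Lucas-Leonardo numbers are defined by $\mathcal{R}_{0}=3$, $\mathcal{R}_{1}=1$, $\mathcal{R}_{n}=\mathcal{R}_{n-1}+\mathcal{R}_{n-2}+1$ for $n\geq 2$. For an odd prime $q$, let $\mathbb{Z}_q$ be the field with $q$ elements and $\mathbb{Q}_{\mathbb{Z}_{q}}$ the quaternion algebra over $\mathbb{Z}_q$ with basis $1,i,j,k$ and relations $i^{2}=j^{2}=-1$, $ij=-ji=k$. The $n$-th Lucas-Leonardo quaternion is $\mathbb{Q}\mathcal{R}_{n}=\mathcal{R}_{n}+\mathcal{R}_{n+1}i+\mathcal{R}_{n+2}j+\mathcal{R}_{n+3}k$, regarded as an element of $\mathbb{Q}_{\mathbb{Z}_{q}}$ by reducing its coefficients modulo $q$. *)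

theory Defs
  imports "Berlekamp_Zassenhaus.Finite_Field"
begin

fun lucas_leonardo :: "nat \<Rightarrow> nat" where
  "lucas_leonardo 0 = 3"
| "lucas_leonardo (Suc 0) = 1"
| "lucas_leonardo (Suc (Suc n)) = lucas_leonardo (Suc n) + lucas_leonardo n + 1"

text \<open>\<open>Quat a b c d\<close> stands for $a + bi + cj + dk$.\<close>

datatype 'a quat = Quat (Re_q: 'a) (Im_i: 'a) (Im_j: 'a) (Im_k: 'a)

instantiation quat :: (comm_ring_1) ring_1
begin

definition zero_quat :: "'a quat" where
  "0 = Quat 0 0 0 0"

definition one_quat :: "'a quat" where
  "1 = Quat 1 0 0 0"

definition plus_quat :: "'a quat \<Rightarrow> 'a quat \<Rightarrow> 'a quat" where
  "x + y = Quat (Re_q x + Re_q y) (Im_i x + Im_i y) (Im_j x + Im_j y) (Im_k x + Im_k y)"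

definition uminus_quat :: "'a quat \<Rightarrow> 'a quat" where
  "- x = Quat (- Re_q x) (- Im_i x) (- Im_j x) (- Im_k x)"

definition minus_quat :: "'a quat \<Rightarrow> 'a quat \<Rightarrow> 'a quat" where
  "x - y = Quat (Re_q x - Re_q y) (Im_i x - Im_i y) (Im_j x - Im_j y) (Im_k x - Im_k y)"

definition times_quat :: "'a quat \<Rightarrow> 'a quat \<Rightarrow> 'a quat" where
  "x * y = Quat
     (Re_q x * Re_q y - Im_i x * Im_i y - Im_j x * Im_j y - Im_k x * Im_k y)
     (Re_q x * Im_i y + Im_i x * Re_q y + Im_j x * Im_k y - Im_k x * Im_j y)
     (Re_q x * Im_j y - Im_i x * Im_k y + Im_j x * Re_q y + Im_k x * Im_i y)
     (Re_q x * Im_k y + Im_i x * Im_j y - Im_j x * Im_i y + Im_k x * Re_q y)"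

instance
  by standard
    (simp_all add: zero_quat_def one_quat_def plus_quat_def uminus_quat_def
      minus_quat_def times_quat_def algebra_simps)

end

definition quat_of :: "'a::comm_ring_1 \<Rightarrow> 'a quat" where
  "quat_of a = Quat a 0 0 0"

definition quat_i :: "'a::comm_ring_1 quat" where
  "quat_i = Quat 0 1 0 0"

definition quat_j :: "'a::comm_ring_1 quat" where
  "quat_j = Quat 0 0 1 0"

definition quat_k :: "'a::comm_ring_1 quat" where
  "quat_k = Quat 0 0 0 1"

lemma quat_relations:
  "quat_i * quat_i = (- 1 :: 'a::comm_ring_1 quat)"
  "quat_j * quat_j = (- 1 :: 'a quat)"
  "quat_i * quat_j = (quat_k :: 'a quat)"
  "quat_j * quat_i = (- quat_k :: 'a quat)"
  by (simp_all add: quat_i_def quat_j_def quat_k_def one_quat_def uminus_quat_def times_quat_def)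

lemma quat_of_central: "quat_of a * x = x * quat_of a"
  by (simp add: quat_of_def times_quat_def mult.commute)

lemma Quat_eq_basis:
  "Quat a b c d = quat_of a + quat_of b * quat_i + quat_of c * quat_j + quat_of d * quat_k"
  by (simp add: quat_of_def quat_i_def quat_j_def quat_k_def plus_quat_def times_quat_def)

definition lucas_leonardo_quat :: "nat \<Rightarrow> 'a::comm_ring_1 quat" where
  "lucas_leonardo_quat n =
     quat_of (of_nat (lucas_leonardo n))
     + quat_of (of_nat (lucas_leonardo (n + 1))) * quat_i
     + quat_of (of_nat (lucas_leonardo (n + 2))) * quat_j
     + quat_of (of_nat (lucas_leonardo (n + 3))) * quat_k"

text \<open>Zero itself is not counted as a zero divisor, and a left or a right zero divisor
  qualifies; \<open>mult_zero_class.zero_divisor\<close> admits zero and is one-sided.\<close>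

definition proper_zero_divisor :: "'a::ring_1 \<Rightarrow> bool" where
  "proper_zero_divisor x \<longleftrightarrow> x \<noteq> 0 \<and> (\<exists>y. y \<noteq> 0 \<and> (x * y = 0 \<or> y * x = 0))"

end

theory Submission
  imports Defs
begin

text \<open>Over an integral domain, a non-zero quaternion \<open>x\<close> is a zero divisor exactly when its norm
  (the sum of the squares of its coefficients) vanishes. Indeed \<open>x\<close> times its conjugate is the norm,
  a central scalar: if the norm is zero, the conjugate is the missing cofactor; if it is not zero,
  multiplying \<open>x * y = 0\<close> by the conjugate shows that all coefficients of \<open>y\<close> vanish
  (\<open>proper_zero_divisor_quat_iff\<close>).

  A Lucas-Leonardo quaternion is never zero, since three consecutive zero coefficients would violate
  the recurrence because of its summand 1. So everything depends on whether 7 divides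
  \<open>R\<^sub>n\<^sup>2 + R\<^sub>n\<^sub>+\<^sub>1\<^sup>2 + R\<^sub>n\<^sub>+\<^sub>2\<^sup>2 + R\<^sub>n\<^sub>+\<^sub>3\<^sup>2\<close>. Modulo 7 the sequence has period 16, because the recurrence
  has order two and the pair \<open>(3, 1)\<close> recurs at index 16 (\<open>lucas_leonardo_cong_mod_16\<close>). Hence the
  divisibility depends only on \<open>n mod 16\<close>, and sixteen evaluations decide it.\<close>

definition quat_norm :: "'a::comm_ring_1 quat \<Rightarrow> 'a" where
  "quat_norm x = Re_q x * Re_q x + Im_i x * Im_i x + Im_j x * Im_j x + Im_k x * Im_k x"

definition quat_conj :: "'a::comm_ring_1 quat \<Rightarrow> 'a quat" where
  "quat_conj x = Quat (Re_q x) (- Im_i x) (- Im_j x) (- Im_k x)"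

lemma quat_mult_conj: "x * quat_conj x = quat_of (quat_norm x)"
  by (simp add: times_quat_def quat_conj_def quat_norm_def quat_of_def algebra_simps)

lemma quat_conj_mult: "quat_conj x * x = quat_of (quat_norm x)"
  by (simp add: times_quat_def quat_conj_def quat_norm_def quat_of_def algebra_simps)

lemma quat_conj_eq_0_iff [simp]: "quat_conj x = 0 \<longleftrightarrow> x = 0"
  by (cases x) (simp add: quat_conj_def zero_quat_def)

lemma quat_of_0 [simp]: "quat_of 0 = 0"
  by (simp add: quat_of_def zero_quat_def)

lemma quat_of_mult_eq_0_iff:
  fixes a :: "'a::idom"
  shows "quat_of a * y = 0 \<longleftrightarrow> a = 0 \<or> y = 0"
  by (cases y) (auto simp: quat_of_def times_quat_def zero_quat_def)

lemma proper_zero_divisor_quat_iff: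
  fixes x :: "'a::idom quat"
  shows "proper_zero_divisor x \<longleftrightarrow> x \<noteq> 0 \<and> quat_norm x = 0"
proof (intro iffI conjI)
  assume "proper_zero_divisor x"
  then obtain y where "x \<noteq> 0" "y \<noteq> 0" and y: "x * y = 0 \<or> y * x = 0"
    by (auto simp: proper_zero_divisor_def)
  from y have "quat_of (quat_norm x) * y = 0"
  proof
    assume "x * y = 0"
    then show ?thesis
      by (simp add: mult.assoc flip: quat_conj_mult)
  next
    assume "y * x = 0"
    then have "y * quat_of (quat_norm x) = 0"
      by (simp flip: quat_mult_conj mult.assoc)
    then show ?thesis
      by (simp add: quat_of_central)
  qed
  with \<open>y \<noteq> 0\<close> show "quat_norm x = 0"
    by (simp add: quat_of_mult_eq_0_iff)
  show "x \<noteq> 0" by fact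
next
  assume "x \<noteq> 0 \<and> quat_norm x = 0"
  then have "x * quat_conj x = 0" "quat_conj x \<noteq> 0"
    by (simp_all add: quat_mult_conj)
  with \<open>x \<noteq> 0 \<and> quat_norm x = 0\<close> show "proper_zero_divisor x"
    unfolding proper_zero_divisor_def by blast
qed

lemma lucas_leonardo_quat_eq_Quat:
  "lucas_leonardo_quat n = Quat (of_nat (lucas_leonardo n)) (of_nat (lucas_leonardo (n + 1)))
     (of_nat (lucas_leonardo (n + 2))) (of_nat (lucas_leonardo (n + 3)))"
  unfolding lucas_leonardo_quat_def Quat_eq_basis ..

text \<open>Three consecutive coefficients cannot all vanish, since the recurrence would read \<open>0 = 1\<close>.\<close>

lemma lucas_leonardo_quat_nonzero: "(lucas_leonardo_quat n :: 'a::comm_ring_1 quat) \<noteq> 0"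
  by (auto simp: lucas_leonardo_quat_eq_Quat zero_quat_def)

definition lucas_leonardo_square_sum :: "nat \<Rightarrow> nat" where
  "lucas_leonardo_square_sum n =
     (lucas_leonardo n)^2 + (lucas_leonardo (n + 1))^2
     + (lucas_leonardo (n + 2))^2 + (lucas_leonardo (n + 3))^2"

lemma quat_norm_lucas_leonardo_quat:
  "quat_norm (lucas_leonardo_quat n) = of_nat (lucas_leonardo_square_sum n)"
  by (simp add: quat_norm_def lucas_leonardo_quat_eq_Quat lucas_leonardo_square_sum_def
      power2_eq_square del: lucas_leonardo.simps)

lemma lucas_leonardo_add_2:
  "lucas_leonardo (n + 2) = lucas_leonardo (n + 1) + lucas_leonardo n + 1"
  by simp

lemma lucas_leonardo_2_3: "lucas_leonardo 2 = 5" "lucas_leonardo 3 = 7"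
  by (simp_all add: eval_nat_numeral)

text \<open>These are the values that enter the norms for \<open>n < 16\<close>; those at 16 and 17 also give the
  period. Instances of the recurrence, read as linear equations between the values, avoid the
  exponential cost of unfolding both recursive calls.\<close>

lemma lucas_leonardo_values:
  "lucas_leonardo 4 = 13" "lucas_leonardo 5 = 21"
  "lucas_leonardo 6 = 35" "lucas_leonardo 7 = 57" "lucas_leonardo 8 = 93"
  "lucas_leonardo 9 = 151" "lucas_leonardo 10 = 245" "lucas_leonardo 11 = 397"
  "lucas_leonardo 12 = 643" "lucas_leonardo 13 = 1041" "lucas_leonardo 14 = 1685"
  "lucas_leonardo 15 = 2727" "lucas_leonardo 16 = 4413" "lucas_leonardo 17 = 7141"
  "lucas_leonardo 18 = 11555"
  using lucas_leonardo_2_3 lucas_leonardo_add_2 [of 2, simplified]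
    lucas_leonardo_add_2 [of 3, simplified] lucas_leonardo_add_2 [of 4, simplified]
    lucas_leonardo_add_2 [of 5, simplified] lucas_leonardo_add_2 [of 6, simplified]
    lucas_leonardo_add_2 [of 7, simplified] lucas_leonardo_add_2 [of 8, simplified]
    lucas_leonardo_add_2 [of 9, simplified] lucas_leonardo_add_2 [of 10, simplified]
    lucas_leonardo_add_2 [of 11, simplified] lucas_leonardo_add_2 [of 12, simplified]
    lucas_leonardo_add_2 [of 13, simplified] lucas_leonardo_add_2 [of 14, simplified]
    lucas_leonardo_add_2 [of 15, simplified] lucas_leonardo_add_2 [of 16, simplified]
  by linarith+

lemma lucas_leonardo_add_16_cong: "[lucas_leonardo (n + 16) = lucas_leonardo n] (mod 7)"
proof (induction n rule: lucas_leonardo.induct)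
  case (3 n)
  then have "[lucas_leonardo (Suc (n + 16)) + lucas_leonardo (n + 16) + 1
      = lucas_leonardo (Suc n) + lucas_leonardo n + 1] (mod 7)"
    unfolding add_Suc by (intro cong_add cong_refl)
  then show ?case
    unfolding add_Suc lucas_leonardo.simps .
qed (simp_all add: cong_def lucas_leonardo_2_3 lucas_leonardo_values)

lemma lucas_leonardo_cong_mod_16:
  "[lucas_leonardo (n + i) = lucas_leonardo (n mod 16 + i)] (mod 7)"
proof -
  have "[lucas_leonardo (m + 16 * k) = lucas_leonardo m] (mod 7)" for m k
  proof (induction k)
    case (Suc k)
    have "[lucas_leonardo (m + 16 * k + 16) = lucas_leonardo (m + 16 * k)] (mod 7)"
      by (rule lucas_leonardo_add_16_cong)
    from cong_trans [OF this Suc] show ?case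
      by (simp add: algebra_simps)
  qed simp
  from this [of "n mod 16 + i" "n div 16"] show ?thesis
    by (simp add: add.assoc [symmetric] add.commute [of _ i])
qed

lemma seven_dvd_lucas_leonardo_square_sum_iff:
  "7 dvd lucas_leonardo_square_sum n \<longleftrightarrow> n mod 16 \<in> {0, 6, 7, 9}"
proof -
  note cong = lucas_leonardo_cong_mod_16 [of n]
  have "[lucas_leonardo_square_sum n = lucas_leonardo_square_sum (n mod 16)] (mod 7)"
    unfolding lucas_leonardo_square_sum_def
    by (intro cong_add cong_pow cong cong [of 0, simplified])
  then have "7 dvd lucas_leonardo_square_sum n \<longleftrightarrow> 7 dvd lucas_leonardo_square_sum (n mod 16)"
    by (rule cong_dvd_iff)
  also have "\<dots> \<longleftrightarrow> n mod 16 \<in> {0, 6, 7, 9}"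
  proof -
    have "\<forall>r\<in>{..<16}. 7 dvd lucas_leonardo_square_sum r \<longleftrightarrow> r \<in> {0, 6, 7, 9}"
      by (simp add: lessThan_nat_numeral lucas_leonardo_square_sum_def
          lucas_leonardo_2_3 lucas_leonardo_values)
    then show ?thesis
      by simp
  qed
  finally show ?thesis .
qed

theorem proposition7:
  fixes n :: nat
  assumes "CARD('q::prime_card) = 7"
  shows "proper_zero_divisor (lucas_leonardo_quat n :: 'q mod_ring quat) \<longleftrightarrow> n mod 16 \<in> {0, 6, 7, 9}"
proof -
  have "proper_zero_divisor (lucas_leonardo_quat n :: 'q mod_ring quat)
      \<longleftrightarrow> (of_nat (lucas_leonardo_square_sum n) :: 'q mod_ring) = 0"
    by (simp add: proper_zero_divisor_quat_iff lucas_leonardo_quat_nonzero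
        quat_norm_lucas_leonardo_quat)
  also have "\<dots> \<longleftrightarrow> 7 dvd lucas_leonardo_square_sum n"
    using assms by (simp add: of_nat_eq_0_iff_char_dvd)
  also have "\<dots> \<longleftrightarrow> n mod 16 \<in> {0, 6, 7, 9}"
    by (rule seven_dvd_lucas_leonardo_square_sum_iff)
  finally show ?thesis .
qed

end
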